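(* Let $\alpha\in\left[\frac1{n+1},1\right)$, and let $\widehat Q^{\widehat\Gamma_a,\mathrm{up}}_{\lambda;D^+}(\alpha)$ be the $i$-th smallest of the $n$ values $\left\|\widehat\Gamma_{a^+}^{-1/2}(Y_j-\hat f_{\lambda^+;D}(X_j))\right\|+\widehat\tau_\lambda^{\widehat\Gamma_{a^+}}(X_j)$, $j=1,\dots,n$, with $i=\lceil(n+1)(1-\alpha)\rceil$. If $\widehat Q^{\widehat\Gamma_a,\mathrm{up}}_{\lambda;D^+}(\alpha)<\sqrt{n+1}$, then the upper G-EllipsoidCP-region is $$\widetilde C^{\widehat\Gamma_a,\mathrm{up}}_{\lambda;\alpha}(X_{n+1})=\left\{y\in\mathcal{Y}:\left\|\widehat\Gamma_{a^+}^{-1/2}\left(y-\hat f_{\lambda^+;D}(X_{n+1})\right)\right\|\le\widetilde Q^{\widehat\Gamma_a,\mathrm{up}}_{\lambda;D^+}(\alpha)\right\},$$ where $$\widetilde Q^{\widehat\Gamma_a,\mathrm{up}}_{\lambda;D^+}(\alpha):=\left(L^{\widehat t_{\lambda;a}}_{\frac1{n+1}}\right)^{-1}\left(\widehat Q^{\widehat\Gamma_a,\mathrm{up}}_{\lambda;D^+}(\alpha);\widehat\tau_\lambda^{\widehat\Gamma_{a^+}}(X_{n+1})\right).$$ Otherwise, $\widetilde C^{\widehat\Gamma_a,\mathrm{up}}_{\lambda;\alpha}(X_{n+1})=\mathcal{Y}$.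
   Context: $\mathcal{X}\subset\mathbb{R}^d$, $\mathcal{Y}\subset\mathbb{R}^p$, $(X_1,Y_1),\dots,(X_n,Y_n)\in\mathcal{X}\times\mathcal{Y}$, $X_{n+1}\in\mathcal{X}$, $\lambda\in(0,+\infty)$, $\lambda^+:=\frac{n+1}n\lambda$, $a\in(0,1)$. $\mathcal{H}$ is a reproducing kernel Hilbert space of functions $\mathcal{X}\to\mathbb{R}^p$ with matrix-valued kernel $K$: for all $x\in\mathcal{X}$, $v\in\mathbb{R}^p$, $K(\cdot,x)v\in\mathcal{H}$ and $\langle K(\cdot,x)v,f\rangle_{\mathcal{H}}=\langle v,f(x)\rangle$ for all $f\in\mathcal{H}$. $\|\cdot\|$ is the Euclidean norm and $\|\cdot\|_{\mathrm{op}}$ the matrix operator norm. The loss $\ell:\mathbb{R}^p\times\mathbb{R}^p\to\mathbb{R}$ is bounded below and, for every $y\in\mathcal{Y}$, $u\mapsto\ell(y,u)$ is convex and $\rho_p$-Lipschitz on $\mathbb{R}^p$ with $\rho_p\in(0,+\infty)$. $D$ consists of $(X_1,Y_1),\dots,(X_n,Y_n)$, and $\hat f_{\lambda^+;D}$ is the (unique) minimizer over $f\in\mathcal{H}$ of $\frac1n\sum_{i=1}^n\ell(Y_i,f(X_i))+\lambda^+\|f\|_{\mathcal{H}}^2$. Let $\widehat\mu_D:=\frac1n\sum_{i=1}^nY_i$, $\widehat\Gamma_{a^+}:=\frac1n\sum_{i=1}^nY_iY_i^T-\widehat\mu_D\widehat\mu_D^T+\frac{a(n+1)}{n}I_p$,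 $$\widehat\tau_\lambda^{\widehat\Gamma_{a^+}}(x):=\|\widehat\Gamma_{a^+}^{-1/2}K(x,x)\widehat\Gamma_{a^+}^{-1/2}\|_{\mathrm{op}}^{1/2}\frac{\rho_p\|K(X_{n+1},X_{n+1})\|_{\mathrm{op}}^{1/2}}{2\lambda(n+1)},\qquad\widehat t_{\lambda;a}:=\|\widehat\Gamma_{a^+}^{-1/2}(\hat f_{\lambda^+;D}(X_{n+1})-\widehat\mu_D)\|.$$ For $y\in\mathcal{Y}$ (with $D^y$ the data set $D$ augmented with $(X_{n+1},y)$) let $$\widetilde S^{\widehat\Gamma_a,\mathrm{lo}}_{\lambda;D^y}(x,u):=\frac{\left(\frac{n+1}{n}\right)^{1/2}\left[\|\widehat\Gamma_{a^+}^{-1/2}(u-\hat f_{\lambda^+;D}(x))\|-\widehat\tau_\lambda^{\widehat\Gamma_{a^+}}(x)\right]}{\left(1+\frac1{n+1}\left(\|\widehat\Gamma_{a^+}^{-1/2}(y-\hat f_{\lambda^+;D}(X_{n+1}))\|+\widehat t_{\lambda;a}\right)^2\right)^{1/2}},$$ $$\widetilde S^{\widehat\Gamma_a,\mathrm{up}}_{\lambda;D^y}(x,u):=\left(\tfrac{n+1}{n}\right)^{1/2}\left[\|\widehat\Gamma_{a^+}^{-1/2}(u-\hat f_{\lambda^+;D}(x))\|+\widehat\tau_\lambda^{\widehat\Gamma_{a^+}}(x)\right].$$ The upper G-EllipsoidCP-region is $$\widetilde C^{\widehat\Gamma_a,\mathrm{up}}_{\lambda;\alpha}(X_{n+1}):=\left\{y\in\mathcal{Y}:\tfrac{1+\sum_{i=1}^n\mathbf{1}\{\widetilde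 S^{\widehat\Gamma_a,\mathrm{up}}_{\lambda;D^y}(X_i,Y_i)\ge\widetilde S^{\widehat\Gamma_a,\mathrm{lo}}_{\lambda;D^y}(X_{n+1},y)\}}{n+1}>\alpha\right\}.$$ For $t,\tau\ge0$, $w>0$, $L_w^t(x;\tau):=\frac{x-\tau}{(1+w(x+t)^2)^{1/2}}$ for $x\in\mathbb{R}_+$; $L_w^t(\cdot;\tau)$ is an increasing bijection from $\mathbb{R}_+$ onto $\left[-\frac{\tau}{(1+wt^2)^{1/2}},w^{-1/2}\right)$, with inverse denoted $(L_w^t)^{-1}(\cdot;\tau)$. *)

theory Defs
  imports "HOL-Analysis.Analysis"
begin

section \<open>Vector-valued reproducing kernel Hilbert spaces\<close>

text \<open>
  A function on the input set \<open>\<X>\<close> is represented by its extension by zero to the whole type, so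
  that pointwise operations and equality of functions on \<open>\<X>\<close> are those of the function type.
  The Hilbert space is a set \<open>H\<close> of such functions with an inner product \<open>ip\<close> on \<open>H\<close>; the values
  of \<open>ip\<close> outside \<open>H\<close> are irrelevant.
\<close>

locale matrix_rkhs =
  fixes \<X> :: "'x set"
    and H :: "('x \<Rightarrow> real ^ 'p) set"
    and ip :: "('x \<Rightarrow> real ^ 'p) \<Rightarrow> ('x \<Rightarrow> real ^ 'p) \<Rightarrow> real"
    and K :: "'x \<Rightarrow> 'x \<Rightarrow> real ^ 'p ^ 'p"
  assumes zero_off: "f \<in> H \<Longrightarrow> x \<notin> \<X> \<Longrightarrow> f x = 0"
    and zero_mem: "(\<lambda>x. 0) \<in> H"
    and add_mem: "f \<in> H \<Longrightarrow> g \<in> H \<Longrightarrow> (\<lambda>x. f x + g x) \<in> H"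
    and scale_mem: "f \<in> H \<Longrightarrow> (\<lambda>x. c *\<^sub>R f x) \<in> H"
    and ip_commute: "f \<in> H \<Longrightarrow> g \<in> H \<Longrightarrow> ip f g = ip g f"
    and ip_add_left:
      "f \<in> H \<Longrightarrow> g \<in> H \<Longrightarrow> h \<in> H \<Longrightarrow> ip (\<lambda>x. f x + g x) h = ip f h + ip g h"
    and ip_scale_left: "f \<in> H \<Longrightarrow> g \<in> H \<Longrightarrow> ip (\<lambda>x. c *\<^sub>R f x) g = c * ip f g"
    and ip_nonneg: "f \<in> H \<Longrightarrow> 0 \<le> ip f f"
    and ip_definite: "f \<in> H \<Longrightarrow> ip f f = 0 \<Longrightarrow> f = (\<lambda>x. 0)"
    and complete: "Metric_space.mcomplete H
      (\<lambda>f g. sqrt (ip (\<lambda>x. f x - g x) (\<lambda>x. f x - g x)))"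
    and kernel_mem: "x \<in> \<X> \<Longrightarrow> (\<lambda>z. if z \<in> \<X> then K z x *v v else 0) \<in> H"
    and reproducing:
      "x \<in> \<X> \<Longrightarrow> f \<in> H \<Longrightarrow> ip (\<lambda>z. if z \<in> \<X> then K z x *v v else 0) f = v \<bullet> f x"

definition reg_risk ::
  "(('x \<Rightarrow> real ^ 'p) \<Rightarrow> ('x \<Rightarrow> real ^ 'p) \<Rightarrow> real) \<Rightarrow> (real ^ 'p \<Rightarrow> real ^ 'p \<Rightarrow> real) \<Rightarrow>
   nat \<Rightarrow> (nat \<Rightarrow> 'x) \<Rightarrow> (nat \<Rightarrow> real ^ 'p) \<Rightarrow> real \<Rightarrow> ('x \<Rightarrow> real ^ 'p) \<Rightarrow> real" where
  "reg_risk ip loss n X Y lam f = (\<Sum>i=1..n. loss (Y i) (f (X i))) / real n + lam * ip f f"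

definition reg_fit ::
  "('x \<Rightarrow> real ^ 'p) set \<Rightarrow> (('x \<Rightarrow> real ^ 'p) \<Rightarrow> ('x \<Rightarrow> real ^ 'p) \<Rightarrow> real) \<Rightarrow>
   (real ^ 'p \<Rightarrow> real ^ 'p \<Rightarrow> real) \<Rightarrow>
   nat \<Rightarrow> (nat \<Rightarrow> 'x) \<Rightarrow> (nat \<Rightarrow> real ^ 'p) \<Rightarrow> real \<Rightarrow> 'x \<Rightarrow> real ^ 'p" where
  "reg_fit H ip loss n X Y lam = (THE f. is_arg_min (reg_risk ip loss n X Y lam) (\<lambda>f. f \<in> H) f)"

section \<open>Regularised empirical covariance\<close>

definition mat_opnorm :: "real ^ 'm ^ 'n \<Rightarrow> real" where
  "mat_opnorm A = onorm ((*v) A)"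

definition outer_prod :: "real ^ 'p \<Rightarrow> real ^ 'p \<Rightarrow> real ^ 'p ^ 'p" where
  "outer_prod u v = (\<chi> i j. u $ i * v $ j)"

text \<open>The symmetric positive semidefinite square root; a symmetric positive semidefinite matrix has
  exactly one.\<close>

definition psd_sqrt :: "real ^ 'p ^ 'p \<Rightarrow> real ^ 'p ^ 'p" where
  "psd_sqrt A = (THE B. transpose B = B \<and> (\<forall>v. 0 \<le> v \<bullet> (B *v v)) \<and> B ** B = A)"

definition inv_sqrt :: "real ^ 'p ^ 'p \<Rightarrow> real ^ 'p ^ 'p" where
  "inv_sqrt A = matrix_inv (psd_sqrt A)"

definition emp_mean :: "nat \<Rightarrow> (nat \<Rightarrow> real ^ 'p) \<Rightarrow> real ^ 'p" where
  "emp_mean n Y = (1 / real n) *\<^sub>R (\<Sum>i=1..n. Y i)"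

definition reg_cov :: "real \<Rightarrow> nat \<Rightarrow> (nat \<Rightarrow> real ^ 'p) \<Rightarrow> real ^ 'p ^ 'p" where
  "reg_cov a n Y = (1 / real n) *\<^sub>R (\<Sum>i=1..n. outer_prod (Y i) (Y i))
     - outer_prod (emp_mean n Y) (emp_mean n Y) + mat (a * real (n + 1) / real n)"

section \<open>Scores and prediction region\<close>

text \<open>
  Below, \<open>G\<close> stands for the inverse square root of the regularised covariance, \<open>f\<close> for the fitted
  predictor, \<open>xnew\<close> for the new input, and \<open>\<tau>\<close> and \<open>t\<close> for the stability bound and the offset.
\<close>

definition tau_hat ::
  "real ^ 'p ^ 'p \<Rightarrow> ('x \<Rightarrow> 'x \<Rightarrow> real ^ 'p ^ 'p) \<Rightarrow> nat \<Rightarrow> 'x \<Rightarrow> real \<Rightarrow> real \<Rightarrow> 'x \<Rightarrow> real" where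
  "tau_hat G K n xnew lam \<rho> x =
     sqrt (mat_opnorm (G ** K x x ** G)) *
     (\<rho> * sqrt (mat_opnorm (K xnew xnew)) / (2 * lam * real (n + 1)))"

definition t_hat ::
  "real ^ 'p ^ 'p \<Rightarrow> ('x \<Rightarrow> real ^ 'p) \<Rightarrow> 'x \<Rightarrow> real ^ 'p \<Rightarrow> real" where
  "t_hat G f xnew \<mu> = norm (G *v (f xnew - \<mu>))"

definition score_lo ::
  "real ^ 'p ^ 'p \<Rightarrow> ('x \<Rightarrow> real ^ 'p) \<Rightarrow> ('x \<Rightarrow> real) \<Rightarrow> real \<Rightarrow> nat \<Rightarrow> 'x \<Rightarrow>
   real ^ 'p \<Rightarrow> 'x \<Rightarrow> real ^ 'p \<Rightarrow> real" where
  "score_lo G f \<tau> t n xnew y x u =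
     sqrt (real (n + 1) / real n) * (norm (G *v (u - f x)) - \<tau> x) /
     sqrt (1 + 1 / real (n + 1) * (norm (G *v (y - f xnew)) + t)\<^sup>2)"

text \<open>The upper score does not depend on the candidate label \<open>y\<close>.\<close>

definition score_up ::
  "real ^ 'p ^ 'p \<Rightarrow> ('x \<Rightarrow> real ^ 'p) \<Rightarrow> ('x \<Rightarrow> real) \<Rightarrow> nat \<Rightarrow> 'x \<Rightarrow> real ^ 'p \<Rightarrow> real" where
  "score_up G f \<tau> n x u = sqrt (real (n + 1) / real n) * (norm (G *v (u - f x)) + \<tau> x)"

definition upper_region ::
  "(real ^ 'p) set \<Rightarrow> nat \<Rightarrow> (nat \<Rightarrow> 'x) \<Rightarrow> (nat \<Rightarrow> real ^ 'p) \<Rightarrow>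
   real ^ 'p ^ 'p \<Rightarrow> ('x \<Rightarrow> real ^ 'p) \<Rightarrow> ('x \<Rightarrow> real) \<Rightarrow> real \<Rightarrow> real \<Rightarrow> (real ^ 'p) set" where
  "upper_region \<Y> n X Y G f \<tau> t \<alpha> =
     {y \<in> \<Y>. (1 + (\<Sum>i=1..n. of_bool
          (score_up G f \<tau> n (X i) (Y i) \<ge> score_lo G f \<tau> t n (X (n + 1)) y (X (n + 1)) y)))
        / real (n + 1) > \<alpha>}"

definition L_fun :: "real \<Rightarrow> real \<Rightarrow> real \<Rightarrow> real \<Rightarrow> real" where
  "L_fun w t \<tau> x = (x - \<tau>) / sqrt (1 + w * (x + t)\<^sup>2)"

definition L_inv :: "real \<Rightarrow> real \<Rightarrow> real \<Rightarrow> real \<Rightarrow> real" where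
  "L_inv w t \<tau> = the_inv_into {0..} (L_fun w t \<tau>)"

text \<open>The \<open>i\<close>-th smallest of \<open>v 1, \<dots>, v n\<close>, counted with multiplicity, for \<open>1 \<le> i \<le> n\<close>.\<close>

definition kth_smallest :: "nat \<Rightarrow> (nat \<Rightarrow> real) \<Rightarrow> nat \<Rightarrow> real" where
  "kth_smallest n v i = sort (map v [1..<n + 1]) ! (i - 1)"

end

theory Submission
  imports Defs
begin

text \<open>The upper scores do not depend on the candidate \<open>y\<close>, so the p-value exceeds \<open>\<alpha>\<close> exactly when
  fewer than \<open>\<lceil>(n + 1) (1 - \<alpha>)\<rceil>\<close> of the rescaled upper scores lie below the rescaled lower score, that
  is, when this lower score is at most the order statistic \<open>Q\<close>. The rescaled lower score is the
  value of \<open>L\<close> at the Mahalanobis-type distance of \<open>y\<close> to the fit; \<open>L\<close> is strictly increasing on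
  the nonnegative reals with supremum \<open>sqrt (n + 1)\<close>, so the condition either can be inverted or is
  void.\<close>

text \<open>In a sorted list the entries below \<open>s\<close> form an initial segment, so the
  entry at the zero-based index \<open>k\<close> belongs to it exactly when the segment has more
  than \<open>k\<close> elements.\<close>

lemma sorted_le_nth_iff_length_filter:
  fixes s :: "'a::linorder"
  assumes "sorted xs" "k < length xs"
  shows "s \<le> xs ! k \<longleftrightarrow> length (filter (\<lambda>x. x < s) xs) \<le> k"
  using assms
proof (induction xs arbitrary: k)
  case (Cons x xs)
  show ?case
  proof (cases "x < s")
    case True
    then show ?thesis using Cons by (cases k) auto
  next
    case False
    \<comment> \<open>The head is the least entry, so no entry is below \<open>s\<close> and both
      sides hold.\<close>
    then have ge: "\<forall>y\<in>set (x # xs). s \<le> y"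
      using Cons.prems(1) by fastforce
    then have "filter (\<lambda>y. y < s) (x # xs) = []"
      by (auto simp: filter_empty_conv not_less)
    moreover have "s \<le> (x # xs) ! k"
      using ge Cons.prems(2) nth_mem by blast
    ultimately show ?thesis by (metis le0 list.size(3))
  qed
qed simp

text \<open>Sorting preserves the number of entries below \<open>s\<close>, and ties are counted by
  index. The list index is \<open>i - 1\<close>; since \<open>1 \<le> i\<close>, "at most
  \<open>i - 1\<close>" means "fewer than \<open>i\<close>".\<close>

lemma le_kth_smallest_iff:
  assumes "1 \<le> i" "i \<le> n"
  shows "s \<le> kth_smallest n v i \<longleftrightarrow> card {j \<in> {1..n}. v j < s} < i"
proof -
  let ?xs = "map v [1..<n + 1]"
  have "length (filter (\<lambda>x. x < s) (sort ?xs)) = length (filter (\<lambda>x. x < s) ?xs)"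
    by (simp add: filter_sort)
  also have "\<dots> = length (filter (\<lambda>j. v j < s) [1..<n + 1])"
    by (simp add: filter_map o_def del: upt_Suc)
  also have "\<dots> = card {j \<in> {1..n}. v j < s}"
    by (subst distinct_card[symmetric]) (auto simp del: upt_Suc intro!: arg_cong[where f = card])
  finally have "s \<le> kth_smallest n v i \<longleftrightarrow> card {j \<in> {1..n}. v j < s} \<le> i - 1"
    unfolding kth_smallest_def using assms
    by (subst sorted_le_nth_iff_length_filter) (simp_all del: upt_Suc)
  then show ?thesis using assms by linarith
qed

lemma kth_smallest_nonneg:
  assumes "1 \<le> i" "i \<le> n" "\<And>j. j \<in> {1..n} \<Longrightarrow> 0 \<le> v j"
  shows "0 \<le> kth_smallest n v i"
proof -
  have "{j \<in> {1..n}. v j < 0} = {}" using assms(3) by force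
  then show ?thesis using assms(1,2) by (simp only: le_kth_smallest_iff) simp
qed

lemma L_fun_strict_mono:
  assumes "0 < w" "0 \<le> t" "0 \<le> \<tau>"
  shows "strict_mono_on {0..} (L_fun w t \<tau>)"
proof (rule strict_mono_onI)
  fix r s :: real
  assume r: "r \<in> {0..}" and "r < s"
  show "L_fun w t \<tau> r < L_fun w t \<tau> s"
  proof (rule DERIV_pos_imp_increasing[OF \<open>r < s\<close>])
    fix x assume "r \<le> x" "x \<le> s"
    define D where "D = 1 + w * (x + t)\<^sup>2"
    have "0 \<le> x" using r \<open>r \<le> x\<close> by simp
    have D: "0 < D" using assms by (simp add: D_def add_pos_nonneg)
    have "((\<lambda>x. sqrt (1 + w * (x + t)\<^sup>2)) has_real_derivative
        inverse (sqrt D) / 2 * (2 * (w * (x + t)))) (at x)"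
    proof (rule DERIV_chain2[where f = sqrt and g = "\<lambda>x. 1 + w * (x + t)\<^sup>2"])
      show "(sqrt has_real_derivative inverse (sqrt D) / 2) (at (1 + w * (x + t)\<^sup>2))"
        using DERIV_real_sqrt[OF D] by (simp only: D_def)
      show "((\<lambda>x. 1 + w * (x + t)\<^sup>2) has_real_derivative 2 * (w * (x + t))) (at x)"
        by (auto intro!: derivative_eq_intros)
    qed
    moreover have "inverse (sqrt D) / 2 * (2 * (w * (x + t))) = w * (x + t) / sqrt D"
      by (simp only: divide_inverse) simp
    ultimately have root: "((\<lambda>x. sqrt (1 + w * (x + t)\<^sup>2)) has_real_derivative
        w * (x + t) / sqrt D) (at x)"
      by (simp only:)
    have diff: "((\<lambda>x. x - \<tau>) has_real_derivative 1) (at x)"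
      by (auto intro!: derivative_eq_intros)
    have sqD: "sqrt D \<noteq> 0" "sqrt D * sqrt D = D" using D by simp_all
    have "(L_fun w t \<tau> has_real_derivative
        (sqrt D - (x - \<tau>) * (w * (x + t) / sqrt D)) / D) (at x)"
      using DERIV_divide[OF diff root] sqD
      by (simp only: L_fun_def[abs_def] D_def[symmetric] mult_1_left simp_thms not_False_eq_True)
    moreover have "(sqrt D - (x - \<tau>) * (w * (x + t) / sqrt D)) / D
        = (1 + w * (x + t) * (t + \<tau>)) / (D * sqrt D)"
    proof -
      have "sqrt D - (x - \<tau>) * (w * (x + t) / sqrt D) = (D - (x - \<tau>) * (w * (x + t))) / sqrt D"
        using D by (simp add: field_simps)
      \<comment> \<open>Factoring out \<open>w * (x + t)\<close> leaves
        \<open>(x + t) - (x - \<tau>) = t + \<tau>\<close>, which is nonnegative; hence the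
        derivative is positive for \<open>x \<ge> 0\<close>.\<close>
      also have "D - (x - \<tau>) * (w * (x + t)) = 1 + w * (x + t) * (t + \<tau>)"
        by (simp add: D_def algebra_simps power2_eq_square)
      finally show ?thesis by (simp add: mult.commute)
    qed
    moreover have "0 < (1 + w * (x + t) * (t + \<tau>)) / (D * sqrt D)"
      using assms D \<open>0 \<le> x\<close> by (intro divide_pos_pos add_pos_nonneg mult_nonneg_nonneg) auto
    ultimately show "\<exists>y. DERIV (L_fun w t \<tau>) x :> y \<and> 0 < y" by metis
  qed
qed

text \<open>The numerator is at most \<open>x + t\<close>, and the 1 under the root makes the
  inequality strict. The bound is never reached, so a threshold equal to it already excludes
  nothing.\<close>

lemma L_fun_less:
  assumes "0 < w" "0 \<le> t" "0 \<le> \<tau>" "0 \<le> x"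
  shows "L_fun w t \<tau> x < 1 / sqrt w"
proof -
  have "(x - \<tau>) * sqrt w \<le> sqrt (w * (x + t)\<^sup>2)"
    using assms by (simp add: real_sqrt_mult mult.commute)
  also have "\<dots> < sqrt (1 + w * (x + t)\<^sup>2)" by simp
  finally show ?thesis
    using assms by (simp add: L_fun_def divide_simps add_pos_nonneg mult.commute)
qed

lemma L_fun_attains:
  assumes "0 < w" "0 \<le> \<tau>" "0 \<le> q" "q < 1 / sqrt w"
  obtains x where "0 \<le> x" "L_fun w t \<tau> x = q"
proof -
  \<comment> \<open>The substitution \<open>x = 1 / u\<close> turns the limit of
    \<open>L_fun\<close> at infinity into the value at 0 of a function continuous there, namely
    \<open>1 / sqrt w\<close>.\<close>
  define g where "g u = (1 - \<tau> * u) / sqrt (u\<^sup>2 + w * (1 + t * u)\<^sup>2)" for u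
  have g: "L_fun w t \<tau> (1 / u) = g u" if "0 < u" for u
  proof -
    have "sqrt (1 + w * (1 / u + t)\<^sup>2) = sqrt ((u\<^sup>2 + w * (1 + t * u)\<^sup>2) / u\<^sup>2)"
      using that by (simp add: field_simps power2_eq_square)
    also have "\<dots> = sqrt (u\<^sup>2 + w * (1 + t * u)\<^sup>2) / u"
      using that by (simp add: real_sqrt_divide)
    finally show ?thesis using that by (simp add: L_fun_def g_def field_simps)
  qed
  have "isCont g 0"
    unfolding g_def using \<open>0 < w\<close> by (intro continuous_intros) simp
  then have "(g \<longlongrightarrow> g 0) (at_right 0)"
    by (simp add: isCont_def filterlim_at_split)
  then have "(g \<longlongrightarrow> 1 / sqrt w) (at_right 0)" by (simp add: g_def)
  then have "\<forall>\<^sub>F u in at_right 0. q < g u \<and> 0 < u"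
    using assms(4) by (intro eventually_conj order_tendstoD(1)[of g] eventually_at_right_less)
  then obtain u where "q < g u" "0 < u"
    using eventually_happens'[OF trivial_limit_at_right_real] by blast
  \<comment> \<open>The point \<open>1 / u\<close> is the right endpoint for the intermediate value
    theorem; the left one is 0, where \<open>L_fun\<close> is at most 0.\<close>
  then have b: "q < L_fun w t \<tau> (1 / u)" "0 \<le> 1 / u" using g by simp_all
  have pos: "0 < 1 + w * (x + t)\<^sup>2" for x
    using \<open>0 < w\<close> by (simp add: add_pos_nonneg)
  have "L_fun w t \<tau> 0 \<le> 0"
    using assms pos[of 0] by (simp add: L_fun_def divide_nonpos_pos)
  moreover have "continuous_on {0..1 / u} (L_fun w t \<tau>)"
    unfolding L_fun_def using pos
    by (intro continuous_intros) (metis less_irrefl real_sqrt_eq_zero_cancel_iff)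
  ultimately show thesis
    using IVT'[of "L_fun w t \<tau>" 0 q "1 / u"] b assms(3) that by (metis less_imp_le order_trans)
qed

text \<open>\<open>L_inv\<close> is a definite description, so \<open>q\<close> must first be shown
  to be attained; strict monotonicity then makes the preimage unique and transfers the
  inequality.\<close>

lemma L_fun_le_iff_le_L_inv:
  assumes "0 < w" "0 \<le> t" "0 \<le> \<tau>" "0 \<le> q" "q < 1 / sqrt w" "0 \<le> x"
  shows "L_fun w t \<tau> x \<le> q \<longleftrightarrow> x \<le> L_inv w t \<tau> q"
proof -
  note mono = L_fun_strict_mono[OF assms(1-3)]
  obtain z where z: "0 \<le> z" "L_fun w t \<tau> z = q"
    using L_fun_attains[OF assms(1,3-5)] .
  then have "L_inv w t \<tau> q = z"
    unfolding L_inv_def using mono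
    by (auto intro!: the_inv_into_f_eq strict_mono_on_imp_inj_on)
  then show ?thesis
    using strict_mono_on_leD[OF mono] strict_mono_onD[OF mono] z assms(6)
    by (metis atLeast_iff not_le)
qed

lemma mat_opnorm_nonneg: "0 \<le> mat_opnorm A"
  unfolding mat_opnorm_def by (intro onorm_pos_le linear_conv_bounded_linear[THEN iffD1]) simp

lemma tau_hat_nonneg:
  assumes "0 < lam" "0 \<le> \<rho>"
  shows "0 \<le> tau_hat G K n xnew lam \<rho> x"
  unfolding tau_hat_def using assms
  by (intro mult_nonneg_nonneg divide_nonneg_nonneg real_sqrt_ge_zero mat_opnorm_nonneg) simp_all

lemma t_hat_nonneg: "0 \<le> t_hat G f xnew \<mu>"
  by (simp add: t_hat_def)

text \<open>Both scores carry the positive factor \<open>sqrt ((n + 1) / n)\<close>, which cancels;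
  what remains of the lower score is \<open>L_fun\<close> with
  \<open>w = 1 / (n + 1)\<close>.\<close>

lemma score_lo_le_score_up_iff:
  assumes "n \<ge> 1"
  shows "score_lo G f \<tau> t n xnew y xnew y \<le> score_up G f \<tau> n x u
    \<longleftrightarrow> L_fun (1 / real (n + 1)) t (\<tau> xnew) (norm (G *v (y - f xnew)))
        \<le> norm (G *v (u - f x)) + \<tau> x"
proof -
  have "0 < sqrt (real (n + 1) / real n)" using assms by simp
  then show ?thesis
    unfolding score_lo_def score_up_def L_fun_def times_divide_eq_right[symmetric]
    by (rule mult_le_cancel_left_pos)
qed

text \<open>The two bounds on \<open>\<alpha>\<close> keep the rank \<open>i\<close> between 1 and
  \<open>n\<close>, so the order statistic is one of the \<open>n\<close> values. The equivalence
  counts the complementary set of values below \<open>s\<close>.\<close>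

lemma rank_condition_iff_le_kth_smallest:
  fixes v :: "nat \<Rightarrow> real"
  assumes "1 / real (n + 1) \<le> \<alpha>" "\<alpha> < 1"
  defines "i \<equiv> nat \<lceil>real (n + 1) * (1 - \<alpha>)\<rceil>"
  shows "1 \<le> i" "i \<le> n"
    and "(1 + (\<Sum>j=1..n. of_bool (s \<le> v j))) / real (n + 1) > \<alpha> \<longleftrightarrow> s \<le> kth_smallest n v i"
proof -
  have r: "0 < real (n + 1) * (1 - \<alpha>)" "real (n + 1) * (1 - \<alpha>) \<le> real n"
    using assms(1,2) by (simp, simp add: field_simps)
  show i: "1 \<le> i" "i \<le> n" unfolding i_def using r by linarith+
  define c where "c = card {j \<in> {1..n}. v j < s}"
  have "card {j \<in> {1..n}. s \<le> v j} + c = card ({j \<in> {1..n}. s \<le> v j} \<union> {j \<in> {1..n}. v j < s})"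
    unfolding c_def by (subst card_Un_disjoint) auto
  also have "{j \<in> {1..n}. s \<le> v j} \<union> {j \<in> {1..n}. v j < s} = {1..n}" by auto
  finally have "real (card {j \<in> {1..n}. s \<le> v j}) = real n - real c" by simp
  moreover have "(\<Sum>j=1..n. of_bool (s \<le> v j)) = real (card {j \<in> {1..n}. s \<le> v j})"
    by (subst sum_of_bool_eq) (auto intro!: arg_cong[where f = card])
  ultimately have "(1 + (\<Sum>j=1..n. of_bool (s \<le> v j))) / real (n + 1) > \<alpha>
      \<longleftrightarrow> (1 + (real n - real c)) / real (n + 1) > \<alpha>"
    by (simp only:)
  also have "\<dots> \<longleftrightarrow> real c < real (n + 1) * (1 - \<alpha>)"
    by (auto simp: field_simps)
  \<comment> \<open>An integer is below a real number iff it is below its ceiling.\<close>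
  also have "\<dots> \<longleftrightarrow> c < i" unfolding i_def by linarith
  also have "\<dots> \<longleftrightarrow> s \<le> kth_smallest n v i"
    using i by (simp only: le_kth_smallest_iff c_def)
  finally show "(1 + (\<Sum>j=1..n. of_bool (s \<le> v j))) / real (n + 1) > \<alpha>
      \<longleftrightarrow> s \<le> kth_smallest n v i" .
qed

lemma upper_region_eq:
  fixes X :: "nat \<Rightarrow> 'x" and Y :: "nat \<Rightarrow> real ^ 'p" and G :: "real ^ 'p ^ 'p"
    and f :: "'x \<Rightarrow> real ^ 'p"
  assumes "n \<ge> 1" "1 / real (n + 1) \<le> \<alpha>" "\<alpha> < 1" "0 \<le> t" "\<And>x. 0 \<le> \<tau> x"
  defines "Q \<equiv> kth_smallest n (\<lambda>j. norm (G *v (Y j - f (X j))) + \<tau> (X j))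
      (nat \<lceil>real (n + 1) * (1 - \<alpha>)\<rceil>)"
  shows "Q < sqrt (real (n + 1)) \<Longrightarrow> upper_region \<Y> n X Y G f \<tau> t \<alpha> =
      {y \<in> \<Y>. norm (G *v (y - f (X (n + 1)))) \<le> L_inv (1 / real (n + 1)) t (\<tau> (X (n + 1))) Q}"
    and "\<not> Q < sqrt (real (n + 1)) \<Longrightarrow> upper_region \<Y> n X Y G f \<tau> t \<alpha> = \<Y>"
proof -
  let ?w = "1 / real (n + 1)" and ?\<tau> = "\<tau> (X (n + 1))"
  let ?N = "\<lambda>y. norm (G *v (y - f (X (n + 1))))"
  note rank = rank_condition_iff_le_kth_smallest[OF assms(2,3)]
  have C: "upper_region \<Y> n X Y G f \<tau> t \<alpha> = {y \<in> \<Y>. L_fun ?w t ?\<tau> (?N y) \<le> Q}"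
    unfolding upper_region_def score_lo_le_score_up_iff[OF assms(1)] Q_def rank(3) ..
  \<comment> \<open>Nonnegativity places \<open>Q\<close> in the range where \<open>L_inv\<close> is
    known to invert \<open>L_fun\<close>.\<close>
  have Q: "0 \<le> Q" unfolding Q_def using rank(1,2) assms(5) by (intro kth_smallest_nonneg) simp_all
  \<comment> \<open>The supremum of \<open>L_fun\<close> for this \<open>w\<close> is exactly the
    threshold of the case distinction.\<close>
  have w: "0 < ?w" "1 / sqrt ?w = sqrt (real (n + 1))" by (simp_all add: real_sqrt_divide)
  show "upper_region \<Y> n X Y G f \<tau> t \<alpha> = {y \<in> \<Y>. ?N y \<le> L_inv ?w t ?\<tau> Q}"
    if "Q < sqrt (real (n + 1))"
    using L_fun_le_iff_le_L_inv[OF w(1) assms(4,5) Q, unfolded w(2), OF that norm_ge_zero]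
    unfolding C by blast
  show "upper_region \<Y> n X Y G f \<tau> t \<alpha> = \<Y>" if "\<not> Q < sqrt (real (n + 1))"
  proof -
    have "L_fun ?w t ?\<tau> (?N y) \<le> Q" for y
    proof -
      have "L_fun ?w t ?\<tau> (?N y) < sqrt (real (n + 1))"
        using L_fun_less[OF w(1) assms(4,5) norm_ge_zero] unfolding w(2) .
      also have "\<dots> \<le> Q" using that by (simp only: not_less)
      finally show ?thesis by (rule less_imp_le)
    qed
    then show ?thesis unfolding C by blast
  qed
qed

theorem mainTheorem6:
  fixes \<X> :: "(real ^ 'd) set" and \<Y> :: "(real ^ 'p) set"
    and H :: "(real ^ 'd \<Rightarrow> real ^ 'p) set"
    and ip :: "(real ^ 'd \<Rightarrow> real ^ 'p) \<Rightarrow> (real ^ 'd \<Rightarrow> real ^ 'p) \<Rightarrow> real"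
    and K :: "real ^ 'd \<Rightarrow> real ^ 'd \<Rightarrow> real ^ 'p ^ 'p"
    and loss :: "real ^ 'p \<Rightarrow> real ^ 'p \<Rightarrow> real"
    and n :: nat
    and X :: "nat \<Rightarrow> real ^ 'd" and Y :: "nat \<Rightarrow> real ^ 'p"
    and lam a \<rho> \<alpha> :: real
  assumes "n \<ge> 1"
    and "\<And>i. i \<in> {1..n + 1} \<Longrightarrow> X i \<in> \<X>"
    and "\<And>i. i \<in> {1..n} \<Longrightarrow> Y i \<in> \<Y>"
    and "lam > 0"
    and "0 < a" "a < 1"
    and "matrix_rkhs \<X> H ip K"
    and "bdd_below (range (\<lambda>(y, u). loss y u))"
    and "\<rho> > 0"
    and "\<And>y. y \<in> \<Y> \<Longrightarrow> convex_on UNIV (loss y)"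
    and "\<And>y. y \<in> \<Y> \<Longrightarrow> \<rho>-lipschitz_on UNIV (loss y)"
    and "1 / real (n + 1) \<le> \<alpha>" "\<alpha> < 1"
  shows
    "let G = inv_sqrt (reg_cov a n Y);
         f = reg_fit H ip loss n X Y (real (n + 1) / real n * lam);
         \<tau> = tau_hat G K n (X (n + 1)) lam \<rho>;
         t = t_hat G f (X (n + 1)) (emp_mean n Y);
         C = upper_region \<Y> n X Y G f \<tau> t \<alpha>;
         Q = kth_smallest n (\<lambda>j. norm (G *v (Y j - f (X j))) + \<tau> (X j))
               (nat \<lceil>real (n + 1) * (1 - \<alpha>)\<rceil>)
     in (Q < sqrt (real (n + 1)) \<longrightarrow>
           C = {y \<in> \<Y>. norm (G *v (y - f (X (n + 1))))
                  \<le> L_inv (1 / real (n + 1)) t (\<tau> (X (n + 1))) Q}) \<and>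
        (\<not> Q < sqrt (real (n + 1)) \<longrightarrow> C = \<Y>)"
  \<comment> \<open>Positivity of \<open>lam\<close> and \<open>\<rho>\<close> makes the stability
    bound nonnegative.\<close>
  unfolding Let_def using assms(4,9)
  by (intro conjI impI upper_region_eq[OF assms(1,12,13) t_hat_nonneg tau_hat_nonneg]) simp_all

end
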